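(* Let $X$ and $Y$ be compact metric spaces, let $T_1:X\times Y\to X$ and $T_2:X\times Y\to Y$ be continuous, and let $c:X\times Y\to[0,+\infty)$ be continuous. Let $\Pi(T)$ be the set of Borel probability measures $\pi$ on $X\times Y$ such that for all $f\in C(X)$ and all $g\in C(Y)$ $$\int f(x)\,d\pi(x,y)=\int f(T_1(x,y))\,d\pi(x,y),\qquad \int g(y)\,d\pi(x,y)=\int g(T_2(x,y))\,d\pi(x,y),$$ and let $$\alpha(c)=\inf\left\{\int c\,d\pi:\ \pi\in\Pi(T)\right\}.$$ Then $\alpha(c)$ is the supremum of the set of real numbers $\alpha$ for which there exist continuous functions $\varphi:X\to\mathbb{R}$ and $\psi:Y\to\mathbb{R}$ satisfying $$\alpha+\varphi(x)-\varphi(T_1(x,y))+\psi(y)-\psi(T_2(x,y))\le c(x,y)\qquad\text{for all }(x,y)\in X\times Y.$$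
   Context: $C(X)$ denotes the set of continuous real-valued functions on a compact metric space $X$. The map $T=(T_1,T_2):X\times Y\to X\times Y$ is the continuous self-map with components $T_1,T_2$. *)

theory Defs
  imports "HOL-Probability.Probability"
begin

definition marginal_invariant_measures ::
  "('a::metric_space \<times> 'b::metric_space \<Rightarrow> 'a) \<Rightarrow> ('a \<times> 'b \<Rightarrow> 'b) \<Rightarrow> ('a \<times> 'b) measure set"
where
  "marginal_invariant_measures T1 T2 =
    {\<pi>. prob_space \<pi> \<and> sets \<pi> = sets borel \<and>
       (\<forall>f::'a \<Rightarrow> real. continuous_on UNIV f \<longrightarrow>
          (\<integral>z. f (fst z) \<partial>\<pi>) = (\<integral>z. f (T1 z) \<partial>\<pi>)) \<and>
       (\<forall>g::'b \<Rightarrow> real. continuous_on UNIV g \<longrightarrow>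
          (\<integral>z. g (snd z) \<partial>\<pi>) = (\<integral>z. g (T2 z) \<partial>\<pi>))}"

(* The infimum is taken in the extended reals, so that it is meaningful without knowing
   beforehand that the set of measures is nonempty (the infimum of {} is \<infinity>). Each integral
   is a genuine real number when c is continuous and the two spaces are compact. *)
definition min_cost ::
  "('a::metric_space \<times> 'b::metric_space \<Rightarrow> 'a) \<Rightarrow> ('a \<times> 'b \<Rightarrow> 'b) \<Rightarrow> ('a \<times> 'b \<Rightarrow> real) \<Rightarrow> ereal"
where
  "min_cost T1 T2 c = (INF \<pi>\<in>marginal_invariant_measures T1 T2. ereal (\<integral>z. c z \<partial>\<pi>))"

end

theory Submission
  imports Defs
begin

text \<open>Weak duality is integration of the constraint. For the converse, no separation theorem is
  needed: over all Borel probability measures \<open>\<mu>\<close>, minimize the penalized cost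
  \<open>\<integral>c d\<mu> + n \<Sum>\<^sub>i\<^sub><\<^sub>n (\<integral>v\<^sub>i d\<mu>)\<^sup>2\<close>, where the \<open>v\<^sub>i\<close> are differences
  \<open>p(T\<^sub>1(x,y)) - p(x)\<close> or \<open>q(T\<^sub>2(x,y)) - q(y)\<close> with \<open>p\<close>, \<open>q\<close> from countable measure-determining
  families. Perturbing a minimizer \<open>\<mu>\<^sub>n\<close> towards point masses shows that
  \<open>\<integral>c d\<mu>\<^sub>n + 2n \<Sum>\<^sub>i\<^sub><\<^sub>n (\<integral>v\<^sub>i d\<mu>\<^sub>n)\<^sup>2\<close> is a feasible \<open>\<alpha>\<close>, hence at most the supremum, so
  weak limits of \<open>\<mu>\<^sub>n\<close> lie in \<open>\<Pi>(T)\<close> and cost no more than the supremum.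

  Weak sequential compactness is obtained from Helly's theorem on the real line instead of Riesz
  representation: a compact metric space has a Borel injection into \<open>\<real>\<close> whose inverse is uniformly
  continuous and so extends to the closure of the range.\<close>

subsection \<open>Coding a compact metric space by reals\<close>

text \<open>The \<open>U n\<close> enumerate the balls of radius \<open>1 / Suc m\<close> around
  finite nets, one net for each \<open>m\<close>. Finiteness of each net makes the index bound
  \<open>N\<close> uniform in \<open>x\<close>; this uniformity later turns agreement of finitely
  many digits into closeness.\<close>

lemma compact_UNIV_small_open_sets:
  assumes "compact (UNIV :: 'a::metric_space set)"
  obtains U :: "nat \<Rightarrow> 'a::metric_space set" where "\<And>n. open (U n)"
    and "\<And>e. 0 < e \<Longrightarrow> \<exists>N. \<forall>x. \<exists>n<N. x \<in> U n \<and> (\<forall>y\<in>U n. dist x y < e)"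
proof -
  have "\<exists>C. finite C \<and> (UNIV :: 'a set) \<subseteq> (\<Union>x\<in>C. ball x (1 / Suc m))" for m
    using assms unfolding compact_eq_totally_bounded by simp
  then obtain C :: "nat \<Rightarrow> 'a set" where C: "\<And>m. finite (C m)"
    "\<And>m. UNIV \<subseteq> (\<Union>x\<in>C m. ball x (1 / Suc m))"
    by metis
  define \<B> where "\<B> = (\<Union>m. (\<lambda>x. ball x (1 / Suc m)) ` C m)"
  have cnt: "countable \<B>"
    unfolding \<B>_def using C(1) by (intro countable_UN) (auto intro: countable_finite)
  have ne: "\<B> \<noteq> {}"
    using C(2)[of 0] by (force simp: \<B>_def)
  define U where "U = from_nat_into \<B>"
  have U: "U n \<in> \<B>" for n
    unfolding U_def using ne by (rule from_nat_into)
  show ?thesis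
  proof (rule that[of U])
    show "open (U n)" for n
      using U[of n] by (auto simp: \<B>_def)
    fix e :: real
    assume "0 < e"
    then obtain m where m: "inverse (real (Suc m)) < e / 2"
      using reals_Archimedean[of "e / 2"] by auto
    define F where "F = (\<lambda>x. ball x (1 / Suc m)) ` C m"
    have F: "finite F" "F \<subseteq> \<B>"
      using C(1) by (auto simp: F_def \<B>_def)
    \<comment> \<open>\<open>N\<close> exceeds the index of every ball of the \<open>m\<close>-th
      net, and the net covers the space, so each \<open>x\<close> meets a ball with index below
      \<open>N\<close>.\<close>
    define N where "N = Suc (Max (insert 0 (to_nat_on \<B> ` F)))"
    have "\<exists>n<N. x \<in> U n \<and> (\<forall>y\<in>U n. dist x y < e)" for x
    proof -
      obtain z where z: "z \<in> C m" "dist z x < 1 / Suc m"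
        using C(2)[of m] by force
      define b where "b = ball z (1 / Suc m)"
      have b: "b \<in> F" "x \<in> b"
        using z by (auto simp: b_def F_def)
      have "to_nat_on \<B> b < N"
        unfolding N_def less_Suc_eq_le using F b by (intro Max_ge) auto
      moreover have "U (to_nat_on \<B> b) = b"
        unfolding U_def using cnt b F by (intro from_nat_into_to_nat_on) auto
      moreover have "dist x y < e" if "y \<in> b" for y
      proof -
        have "dist z y < 1 / Suc m"
          using that by (simp add: b_def)
        then show ?thesis
          using z(2) m dist_triangle[of x y z] by (simp add: dist_commute inverse_eq_divide)
      qed
      ultimately show ?thesis
        using b by (intro exI[of _ "to_nat_on \<B> b"]) simp
    qed
    then show "\<exists>N. \<forall>x. \<exists>n<N. x \<in> U n \<and> (\<forall>y\<in>U n. dist x y < e)"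
      by blast
  qed
qed

text \<open>At the first differing index \<open>m\<close> the digits contribute exactly
  \<open>(1 / 3) ^ m\<close>, while the remaining digits can cancel at most
  \<open>(1 / 3) ^ m / 2\<close>. What is left is at least a third of \<open>(1 / 3) ^ m\<close>,
  and \<open>m < N\<close>. In base 2 the tail could cancel the leading term completely.\<close>

lemma ternary_expansion_gap:
  fixes a b :: "nat \<Rightarrow> real"
  assumes a: "\<And>n. a n \<in> {0, 1}" and b: "\<And>n. b n \<in> {0, 1}" and "n < N" "a n \<noteq> b n"
  shows "(1 / 3) ^ N \<le> \<bar>(\<Sum>n. a n * (1 / 3) ^ n) - (\<Sum>n. b n * (1 / 3) ^ n)\<bar>"
proof -
  define m where "m = (LEAST n. a n \<noteq> b n)"
  have m: "a m \<noteq> b m" "\<And>k. k < m \<Longrightarrow> a k = b k" "m \<le> n"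
    using assms(4) LeastI[of "\<lambda>n. a n \<noteq> b n" n] unfolding m_def
    by (auto intro: Least_le dest: not_less_Least)
  define d where "d n = (a n - b n) * (1 / 3) ^ n" for n
  have d_le: "\<bar>d n\<bar> \<le> (1 / 3) ^ n" for n
    using a[of n] b[of n] by (auto simp: d_def abs_mult)
  have geo: "summable (\<lambda>n. (1 / 3 :: real) ^ n)"
    by (rule summable_geometric) simp
  have a_le: "\<bar>a n * (1 / 3) ^ n\<bar> \<le> (1 / 3) ^ n" for n
    using a[of n] by (auto simp: abs_mult)
  have sa: "summable (\<lambda>n. a n * (1 / 3) ^ n)"
    by (rule summable_comparison_test'[OF geo, of 0]) (use a_le in auto)
  have b_le: "\<bar>b n * (1 / 3) ^ n\<bar> \<le> (1 / 3) ^ n" for n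
    using b[of n] by (auto simp: abs_mult)
  have sb: "summable (\<lambda>n. b n * (1 / 3) ^ n)"
    by (rule summable_comparison_test'[OF geo, of 0]) (use b_le in auto)
  have sd: "summable d"
    by (rule summable_comparison_test'[OF geo, of 0]) (use d_le in auto)
  have "(\<Sum>n. a n * (1 / 3) ^ n) - (\<Sum>n. b n * (1 / 3) ^ n) = (\<Sum>n. d n)"
    using suminf_diff[OF sa sb] by (simp add: d_def left_diff_distrib)
  also have "\<dots> = (\<Sum>n. d (n + Suc m)) + (\<Sum>n<Suc m. d n)"
    by (rule suminf_split_initial_segment[OF sd])
  also have "(\<Sum>n<Suc m. d n) = d m"
    using m(2) by (simp add: d_def)
  finally have eq: "(\<Sum>n. a n * (1 / 3) ^ n) - (\<Sum>n. b n * (1 / 3) ^ n)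
    = (\<Sum>n. d (n + Suc m)) + d m" .
  have dm: "\<bar>d m\<bar> = (1 / 3) ^ m"
    using a[of m] b[of m] m(1) by (auto simp: d_def abs_mult)
  have st: "(\<lambda>n. (1 / 3 :: real) ^ Suc m * (1 / 3) ^ n) sums ((1 / 3) ^ Suc m * (1 / (1 - 1 / 3)))"
    by (intro sums_mult geometric_sums) simp
  have "\<bar>\<Sum>n. d (n + Suc m)\<bar> \<le> (\<Sum>n. (1 / 3 :: real) ^ Suc m * (1 / 3) ^ n)"
  proof (rule norm_suminf_le[of "\<lambda>n. d (n + Suc m)", unfolded real_norm_def])
    show "\<bar>d (n + Suc m)\<bar> \<le> (1 / 3) ^ Suc m * (1 / 3) ^ n" for n
      using d_le[of "n + Suc m"] by (simp add: power_add mult.commute mult.left_commute)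
  qed (use st in \<open>auto simp: sums_iff\<close>)
  also have "\<dots> = (1 / 3) ^ m / 2"
    using sums_unique[OF st] by simp
  finally have "(1 / 3) ^ m / 2 \<le> \<bar>(\<Sum>n. d (n + Suc m)) + d m\<bar>"
    using dm by linarith
  moreover have "(1 / 3 :: real) ^ N \<le> (1 / 3) ^ Suc m"
    using m(3) assms(3) by (intro power_decreasing) auto
  moreover have "(0::real) < (1/3)^m" by simp
  ultimately show ?thesis
    unfolding eq power_Suc by linarith
qed

text \<open>The memberships \<open>x \<in> U n\<close> are read as ternary digits of
  \<open>t x\<close>. Codes closer than \<open>(1 / 3) ^ N\<close> share all digits below
  \<open>N\<close>, so \<open>y\<close> lies in the small set \<open>U n\<close> around
  \<open>x\<close>. The map \<open>t\<close> may be discontinuous; only measurability and control of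
  its inverse are claimed.\<close>

lemma compact_UNIV_real_coding:
  assumes "compact (UNIV :: 'a::metric_space set)"
  obtains t :: "'a::metric_space \<Rightarrow> real" where "t \<in> borel_measurable borel" "\<And>x. t x \<in> {0..2}"
    and "\<And>e. 0 < e \<Longrightarrow> \<exists>d>0. \<forall>x y. \<bar>t x - t y\<bar> < d \<longrightarrow> dist x y < e"
proof -
  obtain U :: "nat \<Rightarrow> 'a set" where U: "\<And>n. open (U n)"
    "\<And>e. 0 < e \<Longrightarrow> \<exists>N. \<forall>x. \<exists>n<N. x \<in> U n \<and> (\<forall>y\<in>U n. dist x y < e)"
    using compact_UNIV_small_open_sets[OF assms] by metis
  define t :: "'a \<Rightarrow> real" where "t x = (\<Sum>n. indicator (U n) x * (1 / 3) ^ n)" for x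
  have geo: "(\<lambda>n. (1 / 3 :: real) ^ n) sums (1 / (1 - 1 / 3))"
    by (rule geometric_sums) simp
  have s: "summable (\<lambda>n. indicator (U n) x * (1 / 3 :: real) ^ n)" for x
    by (rule summable_comparison_test'[of "\<lambda>n. (1 / 3 :: real) ^ n" 0])
       (use geo in \<open>auto simp: sums_iff indicator_def\<close>)
  show ?thesis
  proof (rule that[of t])
    have [measurable]: "U n \<in> sets borel" for n
      using U(1) by simp
    show "t \<in> borel_measurable borel"
      unfolding t_def by measurable
    show "t x \<in> {0..2}" for x
    proof -
      have "t x \<le> (\<Sum>n. (1 / 3 :: real) ^ n)"
        unfolding t_def using s geo
        by (intro suminf_le) (auto simp: sums_iff indicator_def)
      moreover have "0 \<le> t x"
        unfolding t_def by (rule suminf_nonneg[OF s]) auto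
      ultimately show ?thesis
        using sums_unique[OF geo] by simp
    qed
    fix e :: real
    assume "0 < e"
    then obtain N where N: "\<And>x. \<exists>n<N. x \<in> U n \<and> (\<forall>y\<in>U n. dist x y < e)"
      using U(2) by blast
    have "dist x y < e" if "\<bar>t x - t y\<bar> < (1 / 3) ^ N" for x y
    proof -
      obtain n where n: "n < N" "x \<in> U n" "\<forall>y\<in>U n. dist x y < e"
        using N by blast
      have "y \<in> U n"
      proof (rule ccontr)
        assume "y \<notin> U n"
        then have "(1 / 3) ^ N \<le> \<bar>t x - t y\<bar>"
          unfolding t_def using n by (intro ternary_expansion_gap[of _ _ n]) (auto simp: indicator_def)
        then show False
          using that by simp
      qed
      then show ?thesis
        using n by blast
    qed
    then show "\<exists>d>0. \<forall>x y. \<bar>t x - t y\<bar> < d \<longrightarrow> dist x y < e"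
      by (intro exI[of _ "(1 / 3) ^ N"]) auto
  qed
qed

text \<open>For \<open>r\<close> in the closure, points whose codes tend to \<open>r\<close> have a
  convergent subsequence by compactness. Its limit \<open>z\<close> attracts every \<open>x\<close>
  whose code is near \<open>r\<close>, by the hypothesis on \<open>t\<close>. This attraction
  property yields both \<open>h (t x) = x\<close> and continuity.\<close>

lemma uniform_inverse_extends_to_closure:
  fixes t :: "'a::metric_space \<Rightarrow> 'b::metric_space"
  assumes "compact (UNIV :: 'a set)"
    and t: "\<And>e. 0 < e \<Longrightarrow> \<exists>d>0. \<forall>x y. dist (t x) (t y) < d \<longrightarrow> dist x y < e"
  obtains h where "continuous_on (closure (range t)) h" "\<And>x. h (t x) = x"
proof -
  have "\<exists>z. \<forall>e>0. \<exists>d>0. \<forall>x. dist (t x) r < d \<longrightarrow> dist x z < e" if r: "r \<in> closure (range t)" for r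
  proof -
    obtain u where u: "\<And>n. u n \<in> range t" "u \<longlonglongrightarrow> r"
      using r unfolding closure_sequential by blast
    then have "\<forall>n. \<exists>x. u n = t x"
      by blast
    then obtain v where v: "\<And>n. u n = t (v n)"
      by metis
    obtain z s where z: "strict_mono (s :: nat \<Rightarrow> nat)" "(v \<circ> s) \<longlonglongrightarrow> z"
      using compact_imp_seq_compact[OF assms(1)] unfolding seq_compact_def by blast
    have tv: "(\<lambda>n. t (v (s n))) \<longlonglongrightarrow> r"
      using LIMSEQ_subseq_LIMSEQ[OF u(2) z(1)] by (simp add: v comp_def)
    show ?thesis
    proof (intro exI[of _ z] allI impI)
      fix e :: real
      assume e: "0 < e"
      obtain d where d: "d > 0" "\<forall>x y. dist (t x) (t y) < d \<longrightarrow> dist x y < e / 2"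
        using t[of "e / 2"] e by auto
      have "eventually (\<lambda>n. dist (t (v (s n))) r < d / 2) sequentially"
        using tv d by (intro tendstoD) auto
      moreover have "eventually (\<lambda>n. dist (v (s n)) z < e / 2) sequentially"
        using z(2) e unfolding comp_def by (intro tendstoD) auto
      ultimately have "eventually (\<lambda>n. dist (t (v (s n))) r < d / 2 \<and> dist (v (s n)) z < e / 2) sequentially"
        by eventually_elim simp
      then obtain n where n: "dist (t (v (s n))) r < d / 2" "dist (v (s n)) z < e / 2"
        using eventually_happens by fastforce
      have "dist x z < e" if "dist (t x) r < d / 2" for x
      proof -
        have "dist (t x) (t (v (s n))) < d"
          using that n(1) by (rule dist_triangle_half_l)
        then have "dist x (v (s n)) < e / 2"
          using d by blast
        then show ?thesis
          using n(2) dist_triangle[of x z "v (s n)"] by linarith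
      qed
      then show "\<exists>d>0. \<forall>x. dist (t x) r < d \<longrightarrow> dist x z < e"
        using d by (intro exI[of _ "d / 2"]) auto
    qed
  qed
  then obtain h where h: "\<And>r e. r \<in> closure (range t) \<Longrightarrow> 0 < e \<Longrightarrow>
      \<exists>d>0. \<forall>x. dist (t x) r < d \<longrightarrow> dist x (h r) < e"
    by metis
  show ?thesis
  proof (rule that[of h])
    show "h (t x) = x" for x
    proof -
      have "dist x (h (t x)) < e" if "0 < e" for e
      proof -
        have "t x \<in> closure (range t)"
          by (meson closure_subset rangeI subsetD)
        then show ?thesis
          using h[OF _ that] by fastforce
      qed
      then show ?thesis
        by (metis dist_pos_lt less_irrefl)
    qed
    show "continuous_on (closure (range t)) h"
      unfolding continuous_on_iff
    proof (intro ballI allI impI)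
      fix r e
      assume r: "r \<in> closure (range t)" and e: "0 < (e :: real)"
      obtain d where d: "d > 0" "\<forall>x. dist (t x) r < d \<longrightarrow> dist x (h r) < e / 2"
        using h[OF r, of "e / 2"] e by auto
      have "dist (h r') (h r) < e" if r': "r' \<in> closure (range t)" "dist r' r < d / 2" for r'
      proof -
        obtain d' where d': "d' > 0" "\<forall>x. dist (t x) r' < d' \<longrightarrow> dist x (h r') < e / 2"
          using h[OF r'(1), of "e / 2"] e by auto
        \<comment> \<open>The code of \<open>x\<close> is close to both \<open>r\<close> and
          \<open>r'\<close>, so \<open>x\<close> links \<open>h r\<close> to
          \<open>h r'\<close>.\<close>
        obtain x where x: "dist (t x) r' < min (d / 2) d'"
          using r'(1) d(1) d'(1) unfolding closure_approachable
          by (auto dest!: spec[of _ "min (d / 2) d'"])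
        have "dist (t x) r < d"
          using x r'(2) dist_triangle[of "t x" r r'] by simp
        then have "dist x (h r) < e / 2" "dist x (h r') < e / 2"
          using d(2) d'(2) x by auto
        then show ?thesis
          by (metis dist_commute dist_triangle_half_l)
      qed
      then show "\<exists>d>0. \<forall>r'\<in>closure (range t). dist r' r < d \<longrightarrow> dist (h r') (h r) < e"
        using d(1) by (intro exI[of _ "d / 2"]) auto
    qed
  qed
qed

subsection \<open>Weak sequential compactness\<close>

lemma compact_UNIV_continuous_bounded:
  fixes f :: "'a::metric_space \<Rightarrow> real"
  assumes "compact (UNIV :: 'a set)" "continuous_on UNIV f"
  obtains B where "0 \<le> B" "\<And>x. \<bar>f x\<bar> \<le> B"
proof -
  have "bounded (range f)"
    using compact_continuous_image[OF assms(2,1)] by (rule compact_imp_bounded)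
  then obtain B where B: "\<And>x. \<bar>f x\<bar> \<le> B"
    unfolding bounded_iff by auto
  then show ?thesis
    using that[of B] order_trans[OF abs_ge_zero B] by blast
qed

lemma compact_UNIV_continuous_integrable:
  fixes f :: "'a::metric_space \<Rightarrow> real"
  assumes "compact (UNIV :: 'a set)" "continuous_on UNIV f"
    and "prob_space M" "sets M = sets borel"
  shows "integrable M f"
proof -
  interpret prob_space M by fact
  obtain B where "\<And>x. \<bar>f x\<bar> \<le> B"
    using compact_UNIV_continuous_bounded[OF assms(1,2)] by metis
  moreover have "f \<in> borel_measurable M"
    using borel_measurable_continuous_onI[OF assms(2)] assms(4) by (simp cong: measurable_cong_sets)
  ultimately show ?thesis
    by (intro integrable_const_bound[of _ B]) auto
qed

text \<open>The truncated distance to \<open>K\<close> is a bounded continuous test function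
  vanishing exactly on \<open>K\<close>. Its integral is 0 under each \<open>M n\<close>, hence
  under the limit. Nonemptiness of \<open>K\<close> matters because
  \<open>infdist x {} = 0\<close>.\<close>

lemma weak_conv_m_AE_in_closed:
  fixes M :: "nat \<Rightarrow> real measure"
  assumes "real_distribution N" "\<And>n. real_distribution (M n)" "weak_conv_m M N"
    and K: "closed K" "K \<noteq> {}" "\<And>n. AE x in M n. x \<in> K"
  shows "AE x in N. x \<in> K"
proof -
  interpret N: real_distribution N by fact
  define g where "g x = min 1 (infdist x K)" for x
  have cont: "isCont g x" for x
    unfolding g_def by (intro continuous_intros)
  have bound: "norm (g x) \<le> 1" "0 \<le> g x" for x
    using infdist_nonneg[of x K] by (auto simp: g_def)
  have meas: "g \<in> borel_measurable borel"
    using cont by (intro borel_measurable_continuous_onI continuous_at_imp_continuous_on) auto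
  have zero: "g x = 0 \<longleftrightarrow> x \<in> K" for x
    using in_closed_iff_infdist_zero[OF K(1,2), of x] by (auto simp: g_def min_def)
  have "(\<lambda>n. integral\<^sup>L (M n) g) \<longlonglongrightarrow> integral\<^sup>L N g"
    using assms(1-3) cont bound(1) by (intro weak_conv_imp_integral_bdd_continuous_conv) auto
  moreover have "integral\<^sup>L (M n) g = 0" for n
  proof -
    have "integral\<^sup>L (M n) g = integral\<^sup>L (M n) (\<lambda>_. 0)"
      using K(3)[of n] zero by (intro integral_cong_AE)
        (use meas assms(2)[of n] in \<open>auto simp: real_distribution_def real_distribution_axioms_def
           cong: measurable_cong_sets\<close>)
    then show ?thesis by simp
  qed
  ultimately have "integral\<^sup>L N g = 0"
    using LIMSEQ_unique[OF _ tendsto_const] by fastforce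
  moreover have "integrable N g"
    using bound(1) meas by (intro N.integrable_const_bound[of _ 1]) auto
  ultimately have "AE x in N. g x = 0"
    using bound(2) by (subst (asm) integral_nonneg_eq_0_iff_AE) auto
  then show ?thesis
    by (simp add: zero)
qed

text \<open>The measures are pushed to the real line by \<open>t\<close>, where the bounded range
  gives tightness and hence a weak limit \<nu> of a subsequence; \<nu> is carried back by the
  inverse of \<open>t\<close>. Although \<open>t\<close> may be discontinuous, a continuous
  \<open>f\<close> becomes the continuous function \<open>f (h x)\<close> on \<open>K\<close>, so
  weak convergence on the line applies to it.\<close>

lemma compact_UNIV_weak_seq_compact:
  fixes M :: "nat \<Rightarrow> 'a::metric_space measure"
  assumes cpt: "compact (UNIV :: 'a set)"
    and M: "\<And>n. prob_space (M n)" "\<And>n. sets (M n) = sets borel"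
  obtains r N where "strict_mono r" "prob_space N" "sets N = sets borel"
    "\<And>f :: 'a \<Rightarrow> real. continuous_on UNIV f \<Longrightarrow>
      (\<lambda>n. \<integral>x. f x \<partial>M (r n)) \<longlonglongrightarrow> (\<integral>x. f x \<partial>N)"
proof -
  obtain t :: "'a \<Rightarrow> real" where t: "t \<in> borel_measurable borel" "\<And>x. t x \<in> {0..2}"
    "\<And>e. 0 < e \<Longrightarrow> \<exists>d>0. \<forall>x y. \<bar>t x - t y\<bar> < d \<longrightarrow> dist x y < e"
    using compact_UNIV_real_coding[OF cpt] by metis
  obtain h where h: "continuous_on (closure (range t)) h" "\<And>x. h (t x) = x"
    using uniform_inverse_extends_to_closure[OF cpt, of t] t(3) unfolding dist_real_def by metis
  define K where "K = closure (range t)"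
  have K: "closed K" "\<And>x. t x \<in> K"
    unfolding K_def using closure_subset[of "range t"] by auto
  have tM[measurable]: "t \<in> borel_measurable (M n)" for n
    using t(1) M(2) by (simp cong: measurable_cong_sets)
  define D where "D n = distr (M n) borel t" for n
  have D: "real_distribution (D n)" for n
    unfolding D_def using M(1) by (intro prob_space.real_distribution_distr) auto
  have "tight D"
    unfolding tight_def
  proof (intro conjI allI impI)
    fix e :: real
    assume "0 < e"
    \<comment> \<open>Tightness is phrased with intervals open on the left, and the code 0 may
      occur; hence the endpoint -1.\<close>
    have "measure (D n) {-1<..2} = 1" for n
    proof -
      interpret prob_space "M n" by (rule M)
      have "t -` {-1<..2} \<inter> space (M n) = space (M n)"
        using t(2) by (force intro: less_le_trans[of "-1" 0])
      then show ?thesis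
        unfolding D_def by (subst measure_distr) (auto simp: prob_space)
    qed
    then show "\<exists>a b::real. a < b \<and> (\<forall>n. 1 - e < measure (D n) {a<..b})"
      using \<open>0 < e\<close> by (intro exI[of _ "-1"] exI[of _ 2]) auto
  qed (rule D)
  then obtain r \<nu> where r: "strict_mono r" and \<nu>: "real_distribution \<nu>" "weak_conv_m (\<lambda>n. D (r n)) \<nu>"
    using tight_imp_convergent_subsubsequence[of D id] by (auto simp: strict_mono_def comp_def)
  interpret \<nu>: real_distribution \<nu> by fact
  have AE_K: "AE x in \<nu>. x \<in> K"
  proof (rule weak_conv_m_AE_in_closed[OF \<nu>(1) _ \<nu>(2) K(1)])
    show "real_distribution (D (r n))" for n
      using D by simp
    show "AE x in D (r n). x \<in> K" for n
      unfolding D_def using K by (subst AE_distr_iff) auto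
  qed (use K(2) in auto)
  \<comment> \<open>A Borel extension of \<open>h\<close> to the whole line; the value off
    \<open>K\<close> is immaterial because \<nu> is concentrated on \<open>K\<close>.\<close>
  define h' where "h' x = (if x \<in> K then h x else undefined)" for x
  have h'_meas[measurable]: "h' \<in> borel_measurable borel"
    unfolding h'_def using K(1) h(1)
    by (subst measurable_If_restrict_space_iff)
       (auto intro!: borel_measurable_continuous_on_restrict simp: K_def)
  have h't: "h' (t x) = x" for x
    using K(2) h(2) by (simp add: h'_def)
  show ?thesis
  proof (rule that[OF r, of "distr \<nu> borel h'"])
    show "prob_space (distr \<nu> borel h')"
      by (rule \<nu>.prob_space_distr) simp
    show "sets (distr \<nu> borel h') = sets borel"
      by simp
    fix f :: "'a \<Rightarrow> real"
    assume f: "continuous_on UNIV f"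
    obtain B where B: "0 \<le> B" "\<And>x. \<bar>f x\<bar> \<le> B"
      using compact_UNIV_continuous_bounded[OF cpt f] by metis
    have fh: "continuous_on K (\<lambda>x. f (h x))"
      using continuous_on_compose2[OF f h(1)] by (simp add: K_def)
    \<comment> \<open>Tietze extension gives a bounded continuous test function on the whole line
      that agrees with \<open>f\<close> on codes: \<open>g (t x) = f x\<close>.\<close>
    obtain g where g: "continuous_on UNIV g" "\<And>x. x \<in> K \<Longrightarrow> g x = f (h x)"
      "\<And>x. norm (g x) \<le> B"
      using Tietze[OF fh, of UNIV B] B K(1) by auto
    have [measurable]: "g \<in> borel_measurable borel" "f \<in> borel_measurable borel"
      using f g(1) by (auto intro: borel_measurable_continuous_onI)
    have "isCont g x" for x
      using g(1) by (simp add: continuous_on_eq_continuous_at)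
    then have "(\<lambda>n. integral\<^sup>L (D (r n)) g) \<longlonglongrightarrow> integral\<^sup>L \<nu> g"
      using \<nu> D g(3) by (intro weak_conv_imp_integral_bdd_continuous_conv) auto
    moreover have "integral\<^sup>L (D (r n)) g = (\<integral>x. f x \<partial>M (r n))" for n
      unfolding D_def using K(2) g(2) h(2) by (subst integral_distr) auto
    moreover have "integral\<^sup>L \<nu> g = (\<integral>x. f (h' x) \<partial>\<nu>)"
    proof (rule integral_cong_AE)
      show "AE x in \<nu>. g x = f (h' x)"
        using AE_K by eventually_elim (simp add: g(2) h'_def)
    qed auto
    ultimately show "(\<lambda>n. \<integral>x. f x \<partial>M (r n)) \<longlonglongrightarrow> (\<integral>x. f x \<partial>distr \<nu> borel h')"
      by (simp add: integral_distr)
  qed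
qed

text \<open>The mixture of \<open>M\<close> and the point mass at \<open>z\<close> is the law of a
  sample from \<open>M\<close> that is replaced by \<open>z\<close> when an independent coin of bias
  \<open>s\<close> shows \<open>True\<close>. The integral formula is then Fubini.\<close>

lemma prob_space_mixture_point_mass:
  fixes M :: "'a::topological_space measure"
  assumes M: "prob_space M" "sets M = sets borel" and s: "0 \<le> s" "s \<le> 1"
  obtains N where "prob_space N" "sets N = sets borel"
    "\<And>f :: 'a \<Rightarrow> real. f \<in> borel_measurable borel \<Longrightarrow> bounded (range f) \<Longrightarrow>
      (\<integral>x. f x \<partial>N) = (1 - s) * (\<integral>x. f x \<partial>M) + s * f z"
proof -
  interpret M: prob_space M by fact
  define Q where "Q = measure_pmf (bernoulli_pmf s)"
  interpret Q: prob_space Q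
    unfolding Q_def by (rule measure_pmf.prob_space_axioms)
  interpret pair_prob_space Q M ..
  define k where "k = (\<lambda>(b :: bool, x). if b then z else x)"
  have sQ[measurable_cong]: "sets Q = sets (count_space UNIV)"
    by (simp add: Q_def)
  note M(2)[measurable_cong]
  have [measurable]: "k \<in> measurable (Q \<Otimes>\<^sub>M M) borel"
    unfolding k_def by measurable
  show ?thesis
  proof (rule that[of "distr (Q \<Otimes>\<^sub>M M) borel k"])
    show "prob_space (distr (Q \<Otimes>\<^sub>M M) borel k)"
      by (rule prob_space_distr) simp
    fix f :: "'a \<Rightarrow> real"
    assume [measurable]: "f \<in> borel_measurable borel" and "bounded (range f)"
    then obtain B where B: "\<And>x. \<bar>f x\<bar> \<le> B"
      unfolding bounded_iff by auto
    have "(\<integral>x. f x \<partial>distr (Q \<Otimes>\<^sub>M M) borel k) = (\<integral>p. f (k p) \<partial>(Q \<Otimes>\<^sub>M M))"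
      by (simp add: integral_distr)
    also have "\<dots> = (\<integral>b. (\<integral>x. f (k (b, x)) \<partial>M) \<partial>Q)"
      using B by (subst integral_fst') (auto intro!: integrable_const_bound[of _ B])
    also have "\<dots> = (1 - s) * (\<integral>x. f x \<partial>M) + s * f z"
      unfolding Q_def using s by (simp add: k_def M.prob_space)
    finally show "(\<integral>x. f x \<partial>distr (Q \<Otimes>\<^sub>M M) borel k) = (1 - s) * (\<integral>x. f x \<partial>M) + s * f z" .
  qed simp
qed

subsection \<open>Penalized minimization\<close>

text \<open>Direct method: the functional is bounded below by 0 and depends continuously on finitely
  many integrals of continuous functions, so a weak limit of a minimizing sequence attains the
  infimum.\<close>

lemma compact_UNIV_penalized_minimum:
  fixes c :: "'a::metric_space \<Rightarrow> real" and v :: "nat \<Rightarrow> 'a \<Rightarrow> real"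
  assumes cpt: "compact (UNIV :: 'a set)"
    and c: "continuous_on UNIV c" "\<And>z. 0 \<le> c z"
    and v: "\<And>i. continuous_on UNIV (v i)"
    and \<kappa>: "0 \<le> \<kappa>"
  obtains N where "prob_space N" "sets N = sets borel"
    "\<And>M. prob_space M \<Longrightarrow> sets M = sets borel \<Longrightarrow>
      (\<integral>x. c x \<partial>N) + \<kappa> * (\<Sum>i<n. (\<integral>x. v i x \<partial>N)\<^sup>2)
      \<le> (\<integral>x. c x \<partial>M) + \<kappa> * (\<Sum>i<n. (\<integral>x. v i x \<partial>M)\<^sup>2)"
proof -
  define F where "F M = (\<integral>x. c x \<partial>M) + \<kappa> * (\<Sum>i<n. (\<integral>x. v i x \<partial>M)\<^sup>2)" for M
  define A where "A = {M :: 'a measure. prob_space M \<and> sets M = sets borel}"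
  have "return borel undefined \<in> A"
    by (simp add: A_def prob_space_return)
  then have ne: "F ` A \<noteq> {}"
    by blast
  have F_nonneg: "0 \<le> F M" for M
    unfolding F_def using c(2) \<kappa> by (simp add: sum_nonneg)
  then have bdd: "bdd_below (F ` A)"
    by (intro bdd_belowI2)
  define m where "m = Inf (F ` A)"
  have "\<exists>M\<in>A. F M < m + 1 / Suc k" for k
    using cInf_lessD[OF ne, of "m + 1 / Suc k"] by (auto simp: m_def)
  then obtain M where M: "\<And>k. M k \<in> A" "\<And>k. F (M k) < m + 1 / Suc k"
    by metis
  obtain r N where r: "strict_mono r" and N: "prob_space N" "sets N = sets borel"
    and conv: "\<And>f :: 'a \<Rightarrow> real. continuous_on UNIV f \<Longrightarrow>
      (\<lambda>n. \<integral>x. f x \<partial>M (r n)) \<longlonglongrightarrow> (\<integral>x. f x \<partial>N)"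
    using compact_UNIV_weak_seq_compact[OF cpt, of M] M(1) unfolding A_def by auto
  have "(\<lambda>k. F (M (r k))) \<longlonglongrightarrow> F N"
    unfolding F_def by (intro tendsto_intros conv c v)
  moreover have "(\<lambda>k. m + 1 / Suc (r k)) \<longlonglongrightarrow> m + 0"
    using LIMSEQ_subseq_LIMSEQ[OF LIMSEQ_inverse_real_of_nat r]
    by (intro tendsto_intros) (simp add: comp_def inverse_eq_divide)
  ultimately have "F N \<le> m + 0"
    by (rule LIMSEQ_le) (use M(2) less_imp_le in blast)
  then have "F N \<le> m"
    by simp
  moreover have "m \<le> F M'" if "M' \<in> A" for M'
    unfolding m_def using bdd that by (intro cInf_lower) auto
  ultimately have "F N \<le> F M'" if "prob_space M'" "sets M' = sets borel" for M'
    using that by (fastforce simp: A_def)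
  then show ?thesis
    using that[OF N] by (simp add: F_def)
qed

text \<open>Divide by \<open>s\<close> and let \<open>s\<close> tend to 0 along
  \<open>1 / Suc k\<close>.\<close>

lemma linear_coeff_nonneg:
  fixes D Q :: real
  assumes "\<And>s. 0 < s \<Longrightarrow> s \<le> 1 \<Longrightarrow> 0 \<le> s * D + s\<^sup>2 * Q"
  shows "0 \<le> D"
proof -
  have "0 \<le> D + inverse (real (Suc k)) * Q" for k
  proof -
    define s where "s = inverse (real (Suc k))"
    have s: "0 < s" "s \<le> 1"
      by (auto simp: s_def inverse_le_1_iff)
    have "0 \<le> s * (D + s * Q)"
      using assms[OF s] by (simp add: algebra_simps power2_eq_square)
    then show ?thesis
      using s(1) unfolding s_def[symmetric] by (simp add: zero_le_mult_iff)
  qed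
  moreover have "(\<lambda>k. D + inverse (real (Suc k)) * Q) \<longlonglongrightarrow> D + 0 * Q"
    by (intro tendsto_intros LIMSEQ_inverse_real_of_nat)
  ultimately show ?thesis
    using LIMSEQ_le_const by fastforce
qed

text \<open>The first-order condition at a minimizer, in the direction of the point mass at \<open>z\<close>.\<close>

lemma compact_UNIV_penalized_first_order:
  fixes c :: "'a::metric_space \<Rightarrow> real" and v :: "nat \<Rightarrow> 'a \<Rightarrow> real"
  assumes cpt: "compact (UNIV :: 'a set)"
    and c: "continuous_on UNIV c" "\<And>z. 0 \<le> c z"
    and v: "\<And>i. continuous_on UNIV (v i)"
    and \<kappa>: "0 \<le> \<kappa>"
  obtains N where "prob_space N" "sets N = sets borel"
    "\<And>z. (\<integral>x. c x \<partial>N) + 2 * \<kappa> * (\<Sum>i<n. (\<integral>x. v i x \<partial>N)\<^sup>2)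
      \<le> c z + 2 * \<kappa> * (\<Sum>i<n. (\<integral>x. v i x \<partial>N) * v i z)"
proof -
  obtain N where N: "prob_space N" "sets N = sets borel" and min:
    "\<And>M. prob_space M \<Longrightarrow> sets M = sets borel \<Longrightarrow>
      (\<integral>x. c x \<partial>N) + \<kappa> * (\<Sum>i<n. (\<integral>x. v i x \<partial>N)\<^sup>2)
      \<le> (\<integral>x. c x \<partial>M) + \<kappa> * (\<Sum>i<n. (\<integral>x. v i x \<partial>M)\<^sup>2)"
    using compact_UNIV_penalized_minimum[OF cpt c, where v = v and n = n, OF v \<kappa>] by metis
  define C where "C = (\<integral>x. c x \<partial>N)"
  define m where "m i = (\<integral>x. v i x \<partial>N)" for i
  have "C + 2 * \<kappa> * (\<Sum>i<n. (m i)\<^sup>2) \<le> c z + 2 * \<kappa> * (\<Sum>i<n. m i * v i z)" for z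
  proof -
    \<comment> \<open>Moving from \<open>N\<close> to the mixture with weight \<open>s\<close> at
      \<open>z\<close> changes the penalized cost by exactly \<open>s * D + s\<^sup>2 * Q\<close>;
      thus \<open>D\<close> is the directional derivative, and the factor 2 comes from
      differentiating the squares.\<close>
    define D where "D = c z - C + 2 * \<kappa> * (\<Sum>i<n. m i * (v i z - m i))"
    define Q where "Q = \<kappa> * (\<Sum>i<n. (v i z - m i)\<^sup>2)"
    have "0 \<le> s * D + s\<^sup>2 * Q" if s: "0 < s" "s \<le> 1" for s
    proof -
      obtain M where M: "prob_space M" "sets M = sets borel"
        "\<And>f :: 'a \<Rightarrow> real. f \<in> borel_measurable borel \<Longrightarrow> bounded (range f) \<Longrightarrow>
          (\<integral>x. f x \<partial>M) = (1 - s) * (\<integral>x. f x \<partial>N) + s * f z"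
        using prob_space_mixture_point_mass[OF N, of s z] s by auto
      have int: "(\<integral>x. f x \<partial>M) = (1 - s) * (\<integral>x. f x \<partial>N) + s * f z"
        if "continuous_on UNIV f" for f :: "'a \<Rightarrow> real"
        using that compact_continuous_image[OF that cpt]
        by (intro M(3) borel_measurable_continuous_onI compact_imp_bounded)
      have "C + \<kappa> * (\<Sum>i<n. (m i)\<^sup>2)
        \<le> (1 - s) * C + s * c z + \<kappa> * (\<Sum>i<n. ((1 - s) * m i + s * v i z)\<^sup>2)"
        using min[OF M(1,2)] by (simp add: int c v C_def m_def)
      also have "(\<Sum>i<n. ((1 - s) * m i + s * v i z)\<^sup>2) =
        (\<Sum>i<n. (m i)\<^sup>2 + 2 * s * (m i * (v i z - m i)) + s\<^sup>2 * (v i z - m i)\<^sup>2)"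
        by (intro sum.cong) (auto simp: power2_eq_square algebra_simps)
      also have "\<dots> = (\<Sum>i<n. (m i)\<^sup>2) + 2 * s * (\<Sum>i<n. m i * (v i z - m i))
          + s\<^sup>2 * (\<Sum>i<n. (v i z - m i)\<^sup>2)"
        by (simp add: sum.distrib sum_distrib_left)
      finally show ?thesis
        unfolding D_def Q_def by (simp add: algebra_simps)
    qed
    then have "0 \<le> D"
      by (rule linear_coeff_nonneg)
    moreover have "(\<Sum>i<n. m i * (v i z - m i)) = (\<Sum>i<n. m i * v i z) - (\<Sum>i<n. (m i)\<^sup>2)"
      by (simp add: right_diff_distrib sum_subtractf power2_eq_square)
    ultimately show ?thesis
      unfolding D_def by (simp only:) (simp add: right_diff_distrib)
  qed
  then show ?thesis
    using that[OF N] by (simp add: C_def m_def)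
qed

text \<open>With penalty weight \<open>n\<close>, the first-order condition says that the penalized
  value (penalty doubled) is feasible for the weights
  \<open>2 * real n * (\<integral>x. v i x \<partial>N)\<close>, hence at most \<open>S\<close>.
  Since \<open>c\<close> is nonnegative, the \<open>i\<close>-th squared moment is at most
  \<open>S / n\<close> once \<open>i < n\<close>, so a weak limit has all moments zero and cost at
  most \<open>S\<close>.\<close>

lemma compact_UNIV_moment_duality:
  fixes c :: "'a::metric_space \<Rightarrow> real" and v :: "nat \<Rightarrow> 'a \<Rightarrow> real"
  assumes cpt: "compact (UNIV :: 'a set)"
    and c: "continuous_on UNIV c" "\<And>z. 0 \<le> c z"
    and v: "\<And>i. continuous_on UNIV (v i)"
    and S: "\<And>n w \<alpha>. (\<And>z. \<alpha> \<le> c z + (\<Sum>i<n. w i * v i z)) \<Longrightarrow> \<alpha> \<le> S"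
  obtains N where "prob_space N" "sets N = sets borel"
    "(\<integral>x. c x \<partial>N) \<le> S" "\<And>i. (\<integral>x. v i x \<partial>N) = 0"
proof -
  define P where "P n N \<longleftrightarrow> prob_space N \<and> sets N = sets borel \<and>
    (\<integral>x. c x \<partial>N) + 2 * real n * (\<Sum>i<n. (\<integral>x. v i x \<partial>N)\<^sup>2) \<le> S" for n N
  have "\<exists>N. P n N" for n
  proof (rule compact_UNIV_penalized_first_order
      [OF cpt c, where v = v and \<kappa> = "real n" and n = n, OF v of_nat_0_le_iff])
    fix N :: "'a measure"
    assume N: "prob_space N" "sets N = sets borel"
      "\<And>z. (\<integral>x. c x \<partial>N) + 2 * real n * (\<Sum>i<n. (\<integral>x. v i x \<partial>N)\<^sup>2)
        \<le> c z + 2 * real n * (\<Sum>i<n. (\<integral>x. v i x \<partial>N) * v i z)"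
    have "2 * real n * (\<Sum>i<n. (\<integral>x. v i x \<partial>N) * v i z)
        = (\<Sum>i<n. (2 * real n * (\<integral>x. v i x \<partial>N)) * v i z)" for z
      by (simp add: sum_distrib_left mult.assoc)
    then have "(\<integral>x. c x \<partial>N) + 2 * real n * (\<Sum>i<n. (\<integral>x. v i x \<partial>N)\<^sup>2) \<le> S"
      using N(3) by (intro S[of _ "\<lambda>i. 2 * real n * (\<integral>x. v i x \<partial>N)" n]) simp
    then show ?thesis
      using N(1,2) unfolding P_def by blast
  qed
  then obtain M where "\<And>n. P n (M n)"
    by metis
  then have M: "\<And>n. prob_space (M n)" "\<And>n. sets (M n) = sets borel"
    "\<And>n. (\<integral>x. c x \<partial>M n) + 2 * real n * (\<Sum>i<n. (\<integral>x. v i x \<partial>M n)\<^sup>2) \<le> S"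
    by (simp_all add: P_def)
  obtain r N where r: "strict_mono r" and N: "prob_space N" "sets N = sets borel"
    and conv: "\<And>f :: 'a \<Rightarrow> real. continuous_on UNIV f \<Longrightarrow>
      (\<lambda>n. \<integral>x. f x \<partial>M (r n)) \<longlonglongrightarrow> (\<integral>x. f x \<partial>N)"
    using compact_UNIV_weak_seq_compact[OF cpt, of M] M(1,2) by auto
  have c_int: "0 \<le> (\<integral>x. c x \<partial>M n)" for n
    using c(2) by simp
  show ?thesis
  proof (rule that[OF N])
    have "(\<integral>x. c x \<partial>M n) \<le> S" for n
    proof -
      have "0 \<le> 2 * real n * (\<Sum>i<n. (\<integral>x. v i x \<partial>M n)\<^sup>2)"
        by (simp add: sum_nonneg)
      then show ?thesis
        using M(3)[of n] by linarith
    qed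
    then show "(\<integral>x. c x \<partial>N) \<le> S"
      using conv[OF c(1)] by (intro LIMSEQ_le_const2) auto
    fix i
    have "(\<integral>x. v i x \<partial>M n)\<^sup>2 \<le> S * inverse (real n)" if "i < n" for n
    proof -
      have "(\<integral>x. v i x \<partial>M n)\<^sup>2 \<le> (\<Sum>i<n. (\<integral>x. v i x \<partial>M n)\<^sup>2)"
        using that by (intro member_le_sum) auto
      then have "real n * (\<integral>x. v i x \<partial>M n)\<^sup>2 \<le> real n * (\<Sum>i<n. (\<integral>x. v i x \<partial>M n)\<^sup>2)"
        by (intro mult_left_mono) auto
      moreover have "0 \<le> real n * (\<Sum>i<n. (\<integral>x. v i x \<partial>M n)\<^sup>2)"
        by (simp add: sum_nonneg)
      ultimately have "real n * (\<integral>x. v i x \<partial>M n)\<^sup>2 \<le> S"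
        using M(3)[of n] c_int[of n] by simp
      then show ?thesis
        using that by (simp add: field_simps)
    qed
    \<comment> \<open>A strictly increasing \<open>r\<close> satisfies \<open>n \<le> r n\<close>,
      so along the subsequence the moment bound for index \<open>i\<close> holds from
      \<open>Suc i\<close> on.\<close>
    moreover have "i < r n" if "i < n" for n
      using seq_suble[OF r, of n] that by simp
    ultimately have "\<forall>n\<ge>Suc i. (\<integral>x. v i x \<partial>M (r n))\<^sup>2 \<le> S * inverse (real (r n))"
      by (simp add: Suc_le_eq)
    moreover have "(\<lambda>n. (\<integral>x. v i x \<partial>M (r n))\<^sup>2) \<longlonglongrightarrow> (\<integral>x. v i x \<partial>N)\<^sup>2"
      by (intro tendsto_intros conv v)
    moreover have "(\<lambda>n. S * inverse (real (r n))) \<longlonglongrightarrow> S * 0"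
      using LIMSEQ_subseq_LIMSEQ[OF lim_inverse_n r] by (intro tendsto_intros) (simp add: comp_def)
    ultimately have "(\<integral>x. v i x \<partial>N)\<^sup>2 \<le> S * 0"
      by (intro LIMSEQ_le) blast+
    then show "(\<integral>x. v i x \<partial>N) = 0"
      by simp
  qed
qed

section \<open>Countable measure-determining families of continuous functions\<close>

text \<open>Finite intersections of the \<open>U n\<close> form a countable, intersection-stable
  basis \<open>E\<close> of the topology. Integrals of continuous functions increasing to the
  indicator of a proper open set in \<open>E\<close> determine its measure; the whole space has mass
  1. Uniqueness of measures on a generator then gives \<open>M = N\<close>.\<close>

lemma compact_UNIV_measure_determining_sequence:
  assumes cpt: "compact (UNIV :: 'a::metric_space set)"
  obtains \<phi> :: "nat \<Rightarrow> 'a::metric_space \<Rightarrow> real" where "\<And>i. continuous_on UNIV (\<phi> i)"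
    "\<And>M N. prob_space M \<Longrightarrow> prob_space N \<Longrightarrow> sets M = sets borel \<Longrightarrow> sets N = sets borel \<Longrightarrow>
      (\<And>i. (\<integral>x. \<phi> i x \<partial>M) = (\<integral>x. \<phi> i x \<partial>N)) \<Longrightarrow> M = N"
proof -
  obtain U :: "nat \<Rightarrow> 'a set" where U: "\<And>n. open (U n)"
    "\<And>e. 0 < e \<Longrightarrow> \<exists>N. \<forall>x. \<exists>n<N. x \<in> U n \<and> (\<forall>y\<in>U n. dist x y < e)"
    using compact_UNIV_small_open_sets[OF cpt] by metis
  define E where "E = (\<lambda>F. \<Inter> (U ` F)) ` {F. finite F}"
  \<comment> \<open>The empty intersection puts \<open>UNIV\<close> into \<open>E\<close>, which
    then serves as the exhausting set of finite measure in the uniqueness argument.\<close>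
  have UNIV_E: "UNIV \<in> E"
    unfolding E_def by (rule image_eqI[of _ _ "{}"]) auto
  have cnt: "countable E"
    unfolding E_def by (intro countable_image countable_Collect_finite)
  have E_open: "open A" if "A \<in> E" for A
    using that U(1) unfolding E_def by (auto intro!: open_INT)
  have "topological_basis E"
  proof (rule topological_basisI)
    fix W :: "'a set" and x
    assume "open W" "x \<in> W"
    then obtain e where e: "0 < e" "ball x e \<subseteq> W"
      using open_contains_ball by blast
    obtain n where n: "x \<in> U n" "\<forall>y\<in>U n. dist x y < e"
      using U(2)[OF e(1)] by blast
    have "U n \<in> E"
      unfolding E_def by (rule image_eqI[of _ _ "{n}"]) auto
    then show "\<exists>B'\<in>E. x \<in> B' \<and> B' \<subseteq> W"
      using n e(2) by (intro bexI[of _ "U n"]) auto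
  qed (rule E_open)
  then have borel_E: "sets (borel :: 'a measure) = sigma_sets UNIV E"
    by (subst borel_eq_countable_basis[OF cnt]) auto
  have "Int_stable E"
  proof (rule Int_stableI)
    fix A B
    assume "A \<in> E" "B \<in> E"
    then obtain F G where "finite F" "finite G" "A = \<Inter> (U ` F)" "B = \<Inter> (U ` G)"
      by (auto simp: E_def)
    then show "A \<inter> B \<in> E"
      unfolding E_def by (intro image_eqI[of _ _ "F \<union> G"]) auto
  qed
  define V where "V = from_nat_into E"
  \<comment> \<open>The index \<open>i\<close> codes a basis set \<open>V a\<close> and a steepness
    \<open>j\<close>. When \<open>V a\<close> is not the whole space, these functions tend to its
    indicator as \<open>j\<close> grows.\<close>
  define \<phi> where "\<phi> i x = (case prod_decode i of (a, j) \<Rightarrow> min 1 (real j * infdist x (- V a)))" for i x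
  show ?thesis
  proof (rule that[of \<phi>])
    show "continuous_on UNIV (\<phi> i)" for i
      unfolding \<phi>_def by (cases "prod_decode i") (auto intro!: continuous_intros)
    fix M N :: "'a measure"
    assume M: "prob_space M" "sets M = sets borel" and N: "prob_space N" "sets N = sets borel"
      and eq: "\<And>i. (\<integral>x. \<phi> i x \<partial>M) = (\<integral>x. \<phi> i x \<partial>N)"
    \<comment> \<open>For \<open>V a = UNIV\<close> the limit would be 0, because the distance to the empty set is 0.\<close>
    have lim: "(\<lambda>j. \<integral>x. \<phi> (prod_encode (a, j)) x \<partial>P) \<longlonglongrightarrow> measure P (V a)"
      if P: "prob_space P" "sets P = sets borel" and a: "V a \<noteq> UNIV" "open (V a)" for P a
    proof -
      interpret prob_space P by fact
      note P(2)[measurable_cong]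
      have [measurable]: "V a \<in> sets borel"
        using a(2) by simp
      have [measurable]: "(\<lambda>x. infdist x (- V a)) \<in> borel_measurable borel"
        by (intro borel_measurable_continuous_onI continuous_intros)
      have "(\<lambda>j. \<integral>x. \<phi> (prod_encode (a, j)) x \<partial>P) \<longlonglongrightarrow> (\<integral>x. indicator (V a) x \<partial>P)"
      proof (rule integral_dominated_convergence[where w = "\<lambda>_. 1"])
        show "AE x in P. (\<lambda>j. \<phi> (prod_encode (a, j)) x) \<longlonglongrightarrow> indicator (V a) x"
        proof (rule AE_I2)
          fix x
          show "(\<lambda>j. \<phi> (prod_encode (a, j)) x) \<longlonglongrightarrow> indicator (V a) x"
          proof (cases "x \<in> V a")
            case False
            then show ?thesis
              by (simp add: \<phi>_def)
          next
            case True
            have "closed (- V a)" "- V a \<noteq> {}"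
              using a by auto
            then have "0 < infdist x (- V a)"
              using True by (subst infdist_pos_not_in_closed) auto
            then obtain k where k: "1 < real k * infdist x (- V a)"
              using reals_Archimedean3 by blast
            have "\<phi> (prod_encode (a, j)) x = 1" if "k \<le> j" for j
            proof -
              have "real k * infdist x (- V a) \<le> real j * infdist x (- V a)"
                using that by (intro mult_right_mono) (auto simp: infdist_nonneg)
              then show ?thesis
                using k by (simp add: \<phi>_def)
            qed
            then show ?thesis
              using True by (intro tendsto_eventually) (auto simp: eventually_sequentially)
          qed
        qed
      qed (auto simp: \<phi>_def infdist_nonneg)
      then show ?thesis
        by simp
    qed
    have "emeasure M A = emeasure N A" if "A \<in> E" for A
    proof (cases "A = UNIV")
      case True
      then show ?thesis
        using M N prob_space.emeasure_space_1[OF M(1)] prob_space.emeasure_space_1[OF N(1)]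
        by (metis sets_eq_imp_space_eq space_borel)
    next
      case False
      obtain a where a: "V a = A"
        unfolding V_def using from_nat_into_surj[OF cnt \<open>A \<in> E\<close>] by blast
      have "measure M A = measure N A"
        using LIMSEQ_unique[OF lim[OF M] lim[OF N, unfolded eq[symmetric]]] False E_open[OF that] a
        by blast
      then show ?thesis
        using M(1) N(1) by (simp add: finite_measure.emeasure_eq_measure prob_space_def)
    qed
    then show "M = N"
      using \<open>Int_stable E\<close> M N UNIV_E borel_E
      by (intro measure_eqI_generator_eq[of E UNIV M N "\<lambda>_. UNIV"])
         (auto simp: prob_space_def finite_measure.emeasure_finite)
  qed
qed

subsection \<open>Duality\<close>

text \<open>This passes from equality of image measures, obtained through countably many test
  functions, to invariance for every continuous function.\<close>

lemma distr_eq_imp_integral_eq: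
  fixes f :: "'b::topological_space \<Rightarrow> real"
  assumes "distr M borel S = distr M borel T" "S \<in> borel_measurable M" "T \<in> borel_measurable M"
    and "f \<in> borel_measurable borel"
  shows "(\<integral>z. f (S z) \<partial>M) = (\<integral>z. f (T z) \<partial>M)"
  using integral_distr[OF assms(2,4)] integral_distr[OF assms(3,4)] assms(1) by simp

theorem theorem4:
  fixes T1 :: "'a::metric_space \<times> 'b::metric_space \<Rightarrow> 'a"
    and T2 :: "'a \<times> 'b \<Rightarrow> 'b"
    and c :: "'a \<times> 'b \<Rightarrow> real"
  assumes "compact (UNIV :: 'a set)"
    and "compact (UNIV :: 'b set)"
    and "continuous_on UNIV T1"
    and "continuous_on UNIV T2"
    and "continuous_on UNIV c"
    and "\<And>z. 0 \<le> c z"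
  shows "min_cost T1 T2 c =
    Sup (ereal ` {\<alpha>::real. \<exists>(\<phi>::'a \<Rightarrow> real) (\<psi>::'b \<Rightarrow> real).
      continuous_on UNIV \<phi> \<and> continuous_on UNIV \<psi> \<and>
      (\<forall>x y. \<alpha> + \<phi> x - \<phi> (T1 (x, y)) + \<psi> y - \<psi> (T2 (x, y)) \<le> c (x, y))})"
    (is "_ = Sup (ereal ` ?R)")
proof (rule antisym)
  have cpt: "compact (UNIV :: ('a \<times> 'b) set)"
    using compact_Times[OF assms(1,2)] by simp
  have cf: "continuous_on UNIV (\<lambda>z :: 'a \<times> 'b. f (fst z))"
    and cT1: "continuous_on UNIV (\<lambda>z. f (T1 z))"
    if "continuous_on UNIV f" for f :: "'a \<Rightarrow> real"
    using that assms(3) by (auto intro!: continuous_on_compose2[OF that] continuous_intros)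
  have cs: "continuous_on UNIV (\<lambda>z :: 'a \<times> 'b. g (snd z))"
    and cT2: "continuous_on UNIV (\<lambda>z. g (T2 z))"
    if "continuous_on UNIV g" for g :: "'b \<Rightarrow> real"
    using that assms(4) by (auto intro!: continuous_on_compose2[OF that] continuous_intros)
  \<comment> \<open>Weak duality: under an invariant \<pi> the \<phi>-terms and the \<psi>-terms of
    the constraint each integrate to 0.\<close>
  have "\<alpha> \<le> (\<integral>z. c z \<partial>\<pi>)"
    if \<alpha>: "\<alpha> \<in> ?R" and \<pi>: "\<pi> \<in> marginal_invariant_measures T1 T2" for \<alpha> \<pi>
  proof -
    obtain \<phi> \<psi> where \<phi>: "continuous_on UNIV \<phi>" and \<psi>: "continuous_on UNIV \<psi>" and le:
      "\<And>x y. \<alpha> + \<phi> x - \<phi> (T1 (x, y)) + \<psi> y - \<psi> (T2 (x, y)) \<le> c (x, y)"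
      using \<alpha> by blast
    have prob: "prob_space \<pi>" and sets: "sets \<pi> = sets borel"
      and inv: "(\<integral>z. \<phi> (fst z) \<partial>\<pi>) = (\<integral>z. \<phi> (T1 z) \<partial>\<pi>)" "(\<integral>z. \<psi> (snd z) \<partial>\<pi>) = (\<integral>z. \<psi> (T2 z) \<partial>\<pi>)"
      using \<pi> \<phi> \<psi> by (auto simp: marginal_invariant_measures_def)
    interpret prob_space \<pi> by (rule prob)
    note int = compact_UNIV_continuous_integrable[OF cpt _ prob sets]
    note [simp] = int[OF cf[OF \<phi>]] int[OF cT1[OF \<phi>]] int[OF cs[OF \<psi>]] int[OF cT2[OF \<psi>]] int[OF assms(5)]
    have "\<alpha> = (\<integral>z. \<alpha> + \<phi> (fst z) - \<phi> (T1 z) + \<psi> (snd z) - \<psi> (T2 z) \<partial>\<pi>)"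
      using inv by (simp add: prob_space)
    also have "\<dots> \<le> (\<integral>z. c z \<partial>\<pi>)"
      by (intro integral_mono) (use le in auto)
    finally show ?thesis .
  qed
  then show "Sup (ereal ` ?R) \<le> min_cost T1 T2 c"
    unfolding min_cost_def by (intro SUP_least INF_greatest) simp
  show "min_cost T1 T2 c \<le> Sup (ereal ` ?R)"
  proof (cases "Sup (ereal ` ?R)")
    case (real S)
    have R_le: "\<alpha> \<le> S" if "\<alpha> \<in> ?R" for \<alpha>
      using SUP_upper[OF that, of ereal] real by simp
    obtain a :: "nat \<Rightarrow> 'a \<Rightarrow> real" where a: "\<And>i. continuous_on UNIV (a i)"
      "\<And>M N. prob_space M \<Longrightarrow> prob_space N \<Longrightarrow> sets M = sets borel \<Longrightarrow> sets N = sets borel \<Longrightarrow>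
        (\<And>i. (\<integral>x. a i x \<partial>M) = (\<integral>x. a i x \<partial>N)) \<Longrightarrow> M = N"
      using compact_UNIV_measure_determining_sequence[OF assms(1)] by blast
    obtain b :: "nat \<Rightarrow> 'b \<Rightarrow> real" where b: "\<And>i. continuous_on UNIV (b i)"
      "\<And>M N. prob_space M \<Longrightarrow> prob_space N \<Longrightarrow> sets M = sets borel \<Longrightarrow> sets N = sets borel \<Longrightarrow>
        (\<And>i. (\<integral>x. b i x \<partial>M) = (\<integral>x. b i x \<partial>N)) \<Longrightarrow> M = N"
      using compact_UNIV_measure_determining_sequence[OF assms(2)] by blast
    \<comment> \<open>Even indices test the first marginal and odd indices the second; padding with
      0 merges both families into the single sequence \<open>v\<close>.\<close>
    define p where "p i = (if even i then a (i div 2) else (\<lambda>_. 0))" for i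
    define q where "q i = (if even i then (\<lambda>_. 0) else b (i div 2))" for i
    have p: "continuous_on UNIV (p i)" and q: "continuous_on UNIV (q i)" for i
      using a(1) b(1) by (auto simp: p_def q_def)
    define v where "v i z = p i (T1 z) - p i (fst z) + (q i (T2 z) - q i (snd z))" for i z
    have v: "continuous_on UNIV (v i)" for i
      unfolding v_def by (intro continuous_on_add continuous_on_diff cf cT1 cs cT2 p q)
    have feasible: "\<alpha> \<le> S" if "\<And>z. \<alpha> \<le> c z + (\<Sum>i<n. w i * v i z)" for n w \<alpha>
    proof (rule R_le)
      \<comment> \<open>The differences in \<open>v\<close> are oriented so that moving the sum to
        the left of the inequality produces the constraint of the dual problem with these
        potentials.\<close>
      define \<phi> where "\<phi> x = (\<Sum>i<n. w i * p i x)" for x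
      define \<psi> where "\<psi> y = (\<Sum>i<n. w i * q i y)" for y
      have "continuous_on UNIV \<phi>" "continuous_on UNIV \<psi>"
        unfolding \<phi>_def \<psi>_def by (intro continuous_intros p q)+
      moreover have "(\<Sum>i<n. w i * v i (x, y)) = \<phi> (T1 (x, y)) - \<phi> x + (\<psi> (T2 (x, y)) - \<psi> y)" for x y
        unfolding v_def \<phi>_def \<psi>_def
        by (simp add: sum.distrib sum_subtractf algebra_simps)
      then have "\<alpha> + \<phi> x - \<phi> (T1 (x, y)) + \<psi> y - \<psi> (T2 (x, y)) \<le> c (x, y)" for x y
        using that[of "(x, y)"] by simp
      ultimately show "\<alpha> \<in> ?R"
        by blast
    qed
    obtain N where N: "prob_space N" "sets N = sets borel" "(\<integral>z. c z \<partial>N) \<le> S"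
      and vN: "\<And>i. (\<integral>z. v i z \<partial>N) = 0"
    proof (rule compact_UNIV_moment_duality[OF cpt assms(5,6), where v = v and S = S])
      show "continuous_on UNIV (v i)" for i
        by (rule v)
      show "\<alpha> \<le> S" if "\<And>z. \<alpha> \<le> c z + (\<Sum>i<n. w i * v i z)" for n w \<alpha>
        using that by (rule feasible)
    qed (rule that)
    interpret prob_space N by fact
    have meas: "h \<in> borel_measurable N" if "continuous_on UNIV h" for h :: "'a \<times> 'b \<Rightarrow> 'c::metric_space"
      using borel_measurable_continuous_onI[OF that] N(2) by (simp cong: measurable_cong_sets)
    have [measurable]: "T1 \<in> borel_measurable N" "T2 \<in> borel_measurable N"
      "fst \<in> borel_measurable N" "snd \<in> borel_measurable N"
      using assms(3,4) by (auto intro!: meas continuous_intros)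
    have [measurable]: "a i \<in> borel_measurable borel" "b i \<in> borel_measurable borel" for i
      using a(1) b(1) by (auto intro: borel_measurable_continuous_onI)
    note int = compact_UNIV_continuous_integrable[OF cpt _ N(1,2)]
    \<comment> \<open>The vanishing moments at the even indices \<open>2 * i\<close> say that both
      image measures agree on every \<open>a i\<close>, and the \<open>a i\<close> determine a
      measure. The odd indices do the same for \<open>snd\<close> and \<open>T2\<close>.\<close>
    have "distr N borel fst = distr N borel T1"
    proof (rule a(2))
      fix i
      have "(\<integral>z. a i (T1 z) - a i (fst z) \<partial>N) = 0"
        using vN[of "2 * i"] by (simp add: v_def p_def q_def)
      then have "(\<integral>z. a i (fst z) \<partial>N) = (\<integral>z. a i (T1 z) \<partial>N)"
        using int[OF cf[OF a(1)]] int[OF cT1[OF a(1)]] by simp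
      then show "(\<integral>x. a i x \<partial>distr N borel fst) = (\<integral>x. a i x \<partial>distr N borel T1)"
        by (simp add: integral_distr)
    qed (auto intro: prob_space_distr)
    moreover have "distr N borel snd = distr N borel T2"
    proof (rule b(2))
      fix i
      have "(\<integral>z. b i (T2 z) - b i (snd z) \<partial>N) = 0"
        using vN[of "2 * i + 1"] by (simp add: v_def p_def q_def)
      then have "(\<integral>z. b i (snd z) \<partial>N) = (\<integral>z. b i (T2 z) \<partial>N)"
        using int[OF cs[OF b(1)]] int[OF cT2[OF b(1)]] by simp
      then show "(\<integral>x. b i x \<partial>distr N borel snd) = (\<integral>x. b i x \<partial>distr N borel T2)"
        by (simp add: integral_distr)
    qed (auto intro: prob_space_distr)
    ultimately have "(\<integral>z. f (fst z) \<partial>N) = (\<integral>z. f (T1 z) \<partial>N)"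
      "(\<integral>z. g (snd z) \<partial>N) = (\<integral>z. g (T2 z) \<partial>N)"
      if "continuous_on UNIV f" "continuous_on UNIV g" for f :: "'a \<Rightarrow> real" and g :: "'b \<Rightarrow> real"
      using that by (auto intro: borel_measurable_continuous_onI
          distr_eq_imp_integral_eq[of N fst T1 f] distr_eq_imp_integral_eq[of N snd T2 g])
    then have "N \<in> marginal_invariant_measures T1 T2"
      unfolding marginal_invariant_measures_def using N(1,2) continuous_on_const by blast
    then have "min_cost T1 T2 c \<le> ereal (\<integral>z. c z \<partial>N)"
      unfolding min_cost_def by (rule INF_lower)
    also have "\<dots> \<le> Sup (ereal ` ?R)"
      using N(3) real by simp
    finally show ?thesis .
  next
    case PInf
    then show ?thesis
      by simp
  next
    case MInf
    \<comment> \<open>Zero potentials make 0 feasible because \<open>c\<close> is nonnegative, so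
      the supremum cannot be -\<infinity>.\<close>
    have "0 \<in> ?R"
      using assms(6) by (auto intro!: exI[of _ "\<lambda>_. 0"])
    then have "ereal 0 \<le> Sup (ereal ` ?R)"
      by (rule SUP_upper)
    then show ?thesis
      using MInf by simp
  qed
qed

end
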